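(* Let $k$ be an algebraically closed field. Then $\mathcal{U}_k(2,\mathbf{G},\mathbf{R})=\mathcal{U}_k(2,\mathbf{A},\mathbf{G},\mathbf{R})$; that is, every unique factorization domain containing $k$, of transcendence degree $2$ over $k$, which is rational over $k$ and admits a positive $\mathbb{Z}$-grading over $k$, is finitely generated as a $k$-algebra.
   Context: $\mathcal{U}_k(2,\mathbf{G},\mathbf{R})$ denotes the set of $k$-isomorphism classes of unique factorization domains $B$ containing $k$, of transcendence degree $2$ over $k$, such that $B$ admits a positive $\mathbb{Z}$-grading over $k$ and $B$ is rational over $k$. $\mathcal{U}_k(2,\mathbf{A},\mathbf{G},\mathbf{R})$ is the subset of classes of those $B$ which are in addition affine over $k$, i.e. finitely generated as $k$-algebras. A domain $B\supset k$ of transcendence degree $n$ is rational over $k$ if its field of fractions is $k$-isomorphic to the field of rational functions in $n$ variables over $k$. A $\mathbb{Z}$-grading $B=\bigoplus_{i\in\mathbb{Z}}B_i$ over $k$ (so $k\subset B_0$) is positive if $B_i=\{0\}$ for $i<0$ and $B_0=k$. *)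

theory Defs
  imports
    "HOL-Library.Poly_Mapping"
    "HOL-Computational_Algebra.Computational_Algebra"
    "Berlekamp_Zassenhaus.Unique_Factorization_Poly"
begin

text \<open>
  A ring containing the field \<open>k\<close> is given by its type \<open>'b\<close> together with the embedding
  \<open>\<iota> :: 'k \<Rightarrow> 'b\<close>, a unital ring homomorphism and hence injective. The class
  \<open>ufd\<close> is \<open>idom\<close> plus existence and uniqueness of factorizations into irreducibles,
  so it carries no additional operations on the ring.
\<close>

text \<open>
  Polynomials over \<open>k\<close> with indeterminates indexed by \<open>'b\<close> itself, and their value at the
  point whose \<open>b\<close>-th coordinate is \<open>b\<close>.
\<close>

definition poly_value ::
  "('k::comm_ring_1 \<Rightarrow> 'b::comm_ring_1) \<Rightarrow> (('b \<Rightarrow>\<^sub>0 nat) \<Rightarrow>\<^sub>0 'k) \<Rightarrow> 'b" where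
  "poly_value \<iota> p =
     (\<Sum>m\<in>Poly_Mapping.keys p. \<iota> (Poly_Mapping.lookup p m) *
        (\<Prod>b\<in>Poly_Mapping.keys m. b ^ Poly_Mapping.lookup m b))"

definition polys_in :: "'b set \<Rightarrow> (('b \<Rightarrow>\<^sub>0 nat) \<Rightarrow>\<^sub>0 'k::zero) set" where
  "polys_in S = {p. \<forall>m\<in>Poly_Mapping.keys p. Poly_Mapping.keys m \<subseteq> S}"

definition affine_over :: "('k::field \<Rightarrow> 'b::idom) \<Rightarrow> bool" where
  "affine_over \<iota> \<longleftrightarrow> (\<exists>S. finite S \<and> poly_value \<iota> ` polys_in S = UNIV)"

definition algebraically_independent :: "('k::field \<Rightarrow> 'b::idom) \<Rightarrow> 'b set \<Rightarrow> bool" where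
  "algebraically_independent \<iota> S \<longleftrightarrow>
     (\<forall>p\<in>polys_in S. poly_value \<iota> p = 0 \<longrightarrow> p = 0)"

definition transcendence_basis :: "('k::field \<Rightarrow> 'b::idom) \<Rightarrow> 'b set \<Rightarrow> bool" where
  "transcendence_basis \<iota> S \<longleftrightarrow> algebraically_independent \<iota> S \<and>
     (\<forall>T. S \<subset> T \<longrightarrow> \<not> algebraically_independent \<iota> T)"

definition has_transcendence_degree :: "('k::field \<Rightarrow> 'b::idom) \<Rightarrow> nat \<Rightarrow> bool" where
  "has_transcendence_degree \<iota> n \<longleftrightarrow>
     (\<exists>S. transcendence_basis \<iota> S \<and> finite S \<and> card S = n)"

text \<open>
  Rationality in transcendence degree 2. The field \<open>k(x,y)\<close> is the fraction field of
  \<open>k[x][y]\<close>, i.e. the type \<open>'k poly poly fract\<close>; the last conjunct says that \<open>\<phi>\<close> is the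
  identity on \<open>k\<close>.
\<close>

definition rational2_over :: "('k::field \<Rightarrow> 'b::idom) \<Rightarrow> bool" where
  "rational2_over \<iota> \<longleftrightarrow>
     (\<exists>\<phi> :: 'b fract \<Rightarrow> 'k poly poly fract.
        field_hom \<phi> \<and> bij \<phi> \<and> (\<forall>a. \<phi> (to_fract (\<iota> a)) = to_fract [:[:a:]:]))"

text \<open>
  The second conjunct says that the ring is the internal direct sum of the \<open>B i\<close>:
  every element has exactly one decomposition, given as a finitely supported family.
\<close>

definition int_grading_over :: "('k::field \<Rightarrow> 'b::idom) \<Rightarrow> (int \<Rightarrow> 'b set) \<Rightarrow> bool" where
  "int_grading_over \<iota> B \<longleftrightarrow>
     (\<forall>i. 0 \<in> B i \<and> (\<forall>x\<in>B i. \<forall>y\<in>B i. x - y \<in> B i)) \<and>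
     (\<forall>b. \<exists>!f :: int \<Rightarrow>\<^sub>0 'b. (\<forall>i. Poly_Mapping.lookup f i \<in> B i) \<and>
        (\<Sum>i\<in>Poly_Mapping.keys f. Poly_Mapping.lookup f i) = b) \<and>
     (\<forall>i j. \<forall>x\<in>B i. \<forall>y\<in>B j. x * y \<in> B (i + j)) \<and>
     range \<iota> \<subseteq> B 0"

definition positive_grading_over :: "('k::field \<Rightarrow> 'b::idom) \<Rightarrow> (int \<Rightarrow> 'b set) \<Rightarrow> bool" where
  "positive_grading_over \<iota> B \<longleftrightarrow>
     int_grading_over \<iota> B \<and> (\<forall>i<0. B i = {0}) \<and> B 0 = range \<iota>"

definition k_isomorphic :: "(('k::field \<Rightarrow> 'b::idom) \<times> ('k \<Rightarrow> 'b)) set" where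
  "k_isomorphic = {(\<iota>, \<iota>'). \<exists>\<sigma> :: 'b \<Rightarrow> 'b. comm_ring_hom \<sigma> \<and> bij \<sigma> \<and> \<sigma> \<circ> \<iota> = \<iota>'}"

text \<open>
  The parts of \<open>U\<^sub>k(2,G,R)\<close> and \<open>U\<^sub>k(2,A,G,R)\<close> made up of the \<open>k\<close>-isomorphism classes
  of rings with underlying ring \<open>'b\<close>. A class is the set of all embeddings of \<open>k\<close> into
  \<open>'b\<close> that yield isomorphic \<open>k\<close>-algebras.
\<close>

definition U2_GR :: "('k::field \<Rightarrow> 'b::ufd) set set" where
  "U2_GR = {\<iota>. comm_ring_hom \<iota> \<and> has_transcendence_degree \<iota> 2 \<and>
     (\<exists>B. positive_grading_over \<iota> B) \<and> rational2_over \<iota>} // k_isomorphic"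

definition U2_AGR :: "('k::field \<Rightarrow> 'b::ufd) set set" where
  "U2_AGR = {\<iota>. comm_ring_hom \<iota> \<and> has_transcendence_degree \<iota> 2 \<and> affine_over \<iota> \<and>
     (\<exists>B. positive_grading_over \<iota> B) \<and> rational2_over \<iota>} // k_isomorphic"

end

theory Submission
  imports Defs
begin

text \<open>
  Write \<open>B = \<Oplus> B\<^sub>n\<close>. Since \<open>B\<close> has two algebraically independent elements, some \<open>B\<^sub>n\<close> has dimension
  at least 2; take \<open>n\<close> minimal and \<open>f, g \<in> B\<^sub>n\<close> linearly independent. A homogeneous prime \<open>p\<close> is
  algebraically dependent on \<open>f\<close> and \<open>g\<close>, and a homogeneous relation, divided by the largest possible
  power of \<open>p\<close>, shows that \<open>p\<close> divides a nonzero form in \<open>f\<close> and \<open>g\<close>. As \<open>k\<close> is algebraically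
  closed, such a form is a product of linear forms, so \<open>p\<close> divides a nonzero linear form \<open>L \<in> B\<^sub>n\<close>.
  Either \<open>L / p\<close> is a constant, or \<open>p\<close> has degree \<open>m < n\<close> and lies in the line \<open>B\<^sub>m\<close>. Hence \<open>B\<close> is
  generated by \<open>f\<close>, \<open>g\<close> and one element of each \<open>B\<^sub>m\<close> with \<open>m < n\<close>. Rationality enters only through
  counts of monomials, which bound the transcendence degree by 2 from both sides.
\<close>

section \<open>Homogeneous linear systems and linear dependence\<close>

text \<open>Gaussian elimination, with unknowns indexed by \<open>I\<close> and equations by
  \<open>J\<close>: an equation with a nonzero coefficient is solved for one unknown, and the
  reduced system still has more unknowns than equations.\<close>

lemma underdetermined_system:
  fixes a :: "'i \<Rightarrow> 'j \<Rightarrow> 'k::field"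
  assumes "finite J" "finite I" "card J < card I"
  shows "\<exists>c. (\<exists>i\<in>I. c i \<noteq> 0) \<and> (\<forall>j\<in>J. (\<Sum>i\<in>I. c i * a i j) = 0)"
  using assms
proof (induction J arbitrary: I a rule: finite_induct)
  case empty
  then have "I \<noteq> {}" by auto
  then show ?case by (intro exI[of _ "\<lambda>_. 1"]) auto
next
  case (insert j J)
  show ?case
  proof (cases "\<forall>i\<in>I. a i j = 0")
    case True
    have "card J < card I" using insert by simp
    from insert.IH[OF insert.prems(1) this, of a]
    obtain c where "\<exists>i\<in>I. c i \<noteq> 0" "\<forall>j\<in>J. (\<Sum>i\<in>I. c i * a i j) = 0" by blast
    with True show ?thesis by (intro exI[of _ c]) simp
  next
    case False
    then obtain i0 where i0: "i0 \<in> I" "a i0 j \<noteq> 0" by blast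
    have "finite (I - {i0})" "card J < card (I - {i0})"
      using insert i0 by (auto simp: card_Diff_singleton_if)
    \<comment> \<open>These are the coefficients after \<open>i0\<close> has been eliminated by
      means of equation \<open>j\<close>.\<close>
    from insert.IH[OF this, of "\<lambda>i j'. a i j' - a i j / a i0 j * a i0 j'"]
    obtain c where c: "\<exists>i\<in>I - {i0}. c i \<noteq> 0"
      and eq: "\<And>j'. j' \<in> J \<Longrightarrow> (\<Sum>i\<in>I - {i0}. c i * (a i j' - a i j / a i0 j * a i0 j')) = 0"
      by blast
    \<comment> \<open>Equation \<open>j\<close> forces this value of the unknown
      \<open>i0\<close>.\<close>
    define c' where "c' = c(i0 := - (\<Sum>i\<in>I - {i0}. c i * a i j) / a i0 j)"
    have split: "(\<Sum>i\<in>I. c' i * a i j') =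
        (\<Sum>i\<in>I - {i0}. c i * (a i j' - a i j / a i0 j * a i0 j'))" for j'
    proof -
      have "(\<Sum>i\<in>I. c' i * a i j') = c' i0 * a i0 j' + (\<Sum>i\<in>I - {i0}. c' i * a i j')"
        using insert.prems(1) i0 by (simp add: sum.remove)
      also have "(\<Sum>i\<in>I - {i0}. c' i * a i j') = (\<Sum>i\<in>I - {i0}. c i * a i j')"
        by (rule sum.cong) (auto simp: c'_def)
      also have "c' i0 * a i0 j' = - (\<Sum>i\<in>I - {i0}. c i * (a i j / a i0 j * a i0 j'))"
        by (simp add: c'_def sum_distrib_left sum_distrib_right sum_divide_distrib sum_negf mult_ac)
      finally show ?thesis by (simp add: sum_subtractf algebra_simps)
    qed
    have "(\<Sum>i\<in>I. c' i * a i j') = 0" if "j' \<in> insert j J" for j'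
      using that i0(2) eq unfolding split by (cases "j' = j") auto
    moreover have "\<exists>i\<in>I. c' i \<noteq> 0" using c by (auto simp: c'_def)
    ultimately show ?thesis by blast
  qed
qed

text \<open>A combination that kills every coordinate is zero, whatever relations hold among the
  \<open>w j\<close>.\<close>

lemma linear_dependence_in_span:
  fixes v :: "'i \<Rightarrow> 'b::comm_ring_1" and a :: "'i \<Rightarrow> 'j \<Rightarrow> 'k::field"
  assumes "comm_ring_hom \<iota>" "finite J" "finite I" "card J < card I"
    and v: "\<And>i. i \<in> I \<Longrightarrow> v i = (\<Sum>j\<in>J. \<iota> (a i j) * w j)"
  shows "\<exists>c. (\<exists>i\<in>I. c i \<noteq> 0) \<and> (\<Sum>i\<in>I. \<iota> (c i) * v i) = 0"
proof -
  interpret comm_ring_hom \<iota> by fact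
  obtain c where c: "\<exists>i\<in>I. c i \<noteq> 0" "\<And>j. j \<in> J \<Longrightarrow> (\<Sum>i\<in>I. c i * a i j) = 0"
    using underdetermined_system[OF assms(2-4)] by blast
  have "(\<Sum>i\<in>I. \<iota> (c i) * v i) = (\<Sum>i\<in>I. \<Sum>j\<in>J. \<iota> (c i * a i j) * w j)"
    by (simp add: v sum_distrib_left hom_mult mult.assoc)
  also have "\<dots> = (\<Sum>j\<in>J. \<iota> (\<Sum>i\<in>I. c i * a i j) * w j)"
    by (subst sum.swap) (simp add: hom_sum sum_distrib_right)
  finally show ?thesis using c by auto
qed

section \<open>Polynomials in two variables of bounded bidegree\<close>

text \<open>In \<open>k[x][y]\<close> this bounds the degrees in \<open>y\<close> and in
  \<open>x\<close> separately; the polynomials allowed form a space of dimension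
  \<open>(M + 1)^2\<close>.\<close>

definition bidegree_le :: "nat \<Rightarrow> 'a::comm_ring_1 poly poly \<Rightarrow> bool" where
  "bidegree_le M P \<longleftrightarrow> degree P \<le> M \<and> (\<forall>j. degree (coeff P j) \<le> M)"

lemma bidegree_le_exists: "\<exists>M. bidegree_le M P"
proof -
  define M where "M = Max (insert (degree P) ((\<lambda>j. degree (coeff P j)) ` {..degree P}))"
  have "degree (coeff P j) \<le> M" for j
    by (cases "j \<le> degree P") (auto simp: M_def coeff_eq_0 not_le intro!: Max_ge simp del: Max_insert)
  moreover have "degree P \<le> M" by (simp add: M_def)
  ultimately show ?thesis unfolding bidegree_le_def by blast
qed

lemma bidegree_le_mono: "bidegree_le M P \<Longrightarrow> M \<le> M' \<Longrightarrow> bidegree_le M' P"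
  unfolding bidegree_le_def by (meson order_trans)

lemma bidegree_le_mult:
  assumes "bidegree_le M P" "bidegree_le M' Q"
  shows "bidegree_le (M + M') (P * Q)"
proof -
  have "degree (coeff (P * Q) j) \<le> M + M'" for j
    unfolding coeff_mult
  proof (rule degree_sum_le)
    fix i assume "i \<in> {..j}"
    have "degree (coeff P i * coeff Q (j - i)) \<le> degree (coeff P i) + degree (coeff Q (j - i))"
      by (rule degree_mult_le)
    also have "\<dots> \<le> M + M'" using assms unfolding bidegree_le_def by (intro add_mono) auto
    finally show "degree (coeff P i * coeff Q (j - i)) \<le> M + M'" .
  qed simp
  moreover have "degree (P * Q) \<le> M + M'"
    using degree_mult_le[of P Q] assms unfolding bidegree_le_def by linarith
  ultimately show ?thesis unfolding bidegree_le_def by blast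
qed

lemma bidegree_le_power: "bidegree_le M P \<Longrightarrow> bidegree_le (n * M) (P ^ n)"
proof (induction n)
  case 0
  then show ?case by (auto simp: bidegree_le_def coeff_pCons split: nat.split)
next
  case (Suc n)
  then show ?case using bidegree_le_mult[of M P "n * M" "P ^ n"] by simp
qed

text \<open>The coefficients of \<open>x^r y^s\<close> with \<open>r, s \<le> M\<close> impose
  \<open>(M + 1)^2\<close> linear conditions, fewer than there are unknowns; all other coefficients
  vanish by the bidegree bound.\<close>

lemma bidegree_le_dependence:
  fixes v :: "'i \<Rightarrow> 'k::field poly poly"
  assumes "finite I" "(M + 1) ^ 2 < card I" and v: "\<And>i. i \<in> I \<Longrightarrow> bidegree_le M (v i)"
  shows "\<exists>c. (\<exists>i\<in>I. c i \<noteq> 0) \<and> (\<Sum>i\<in>I. [:[:c i:]:] * v i) = 0"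
proof -
  define J where "J = {..M} \<times> {..M}"
  have "finite J" "card J < card I" using assms by (auto simp: J_def power2_eq_square)
  from underdetermined_system[OF this(1) assms(1) this(2),
      of "\<lambda>i (r, s). coeff (coeff (v i) s) r"]
  obtain c where c: "\<exists>i\<in>I. c i \<noteq> 0"
    and eq: "\<And>r s. r \<le> M \<Longrightarrow> s \<le> M \<Longrightarrow> (\<Sum>i\<in>I. c i * coeff (coeff (v i) s) r) = 0"
    unfolding J_def by fastforce
  have "coeff (coeff (\<Sum>i\<in>I. [:[:c i:]:] * v i) s) r = 0" for r s
  proof -
    have *: "coeff (coeff (\<Sum>i\<in>I. [:[:c i:]:] * v i) s) r = (\<Sum>i\<in>I. c i * coeff (coeff (v i) s) r)"
      by (simp add: coeff_sum)
    show ?thesis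
    proof (cases "r \<le> M \<and> s \<le> M")
      case True
      then show ?thesis unfolding * by (intro eq) auto
    next
      case False
      have "coeff (coeff (v i) s) r = 0" if "i \<in> I" for i
      proof (cases "s \<le> M")
        case True
        then have "degree (coeff (v i) s) < r"
          using v[OF that] False unfolding bidegree_le_def
          by (meson le_less_trans not_le)
        then show ?thesis by (rule coeff_eq_0)
      next
        case s: False
        then have "degree (v i) < s" using v[OF that] unfolding bidegree_le_def by simp
        then show ?thesis by (simp add: coeff_eq_0)
      qed
      then show ?thesis unfolding * by simp
    qed
  qed
  then have "(\<Sum>i\<in>I. [:[:c i:]:] * v i) = 0" by (intro poly_eqI) (simp only: coeff_0)
  with c show ?thesis by blast
qed

text \<open>There are \<open>(N + 1)^3\<close> products, all of bidegree at most
  \<open>3 * N * M\<close>, hence in a space of dimension quadratic in \<open>N\<close>. The power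
  of \<open>D\<close> homogenizes them, so that \<open>D\<close> can serve as a common
  denominator.\<close>

lemma poly_poly_three_dependent:
  fixes P F G D :: "'k::field poly poly"
  shows "\<exists>N c. (\<exists>t\<in>{..N} \<times> {..N} \<times> {..N}. c t \<noteq> 0) \<and>
    (\<Sum>t\<in>{..N} \<times> {..N} \<times> {..N}. case t of (i, j, l) \<Rightarrow>
       [:[:c (i, j, l):]:] * (P ^ i * F ^ j * G ^ l * D ^ (3 * N - i - j - l))) = 0"
proof -
  obtain a b c d where "bidegree_le a P" "bidegree_le b F" "bidegree_le c G" "bidegree_le d D"
    using bidegree_le_exists by metis
  then obtain M where M: "bidegree_le M P" "bidegree_le M F" "bidegree_le M G" "bidegree_le M D"
    using bidegree_le_mono[of a P "a + b + c + d"] bidegree_le_mono[of b F "a + b + c + d"]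
      bidegree_le_mono[of c G "a + b + c + d"] bidegree_le_mono[of d D "a + b + c + d"] by auto
  \<comment> \<open>With this value \<open>(3NM + 1)^2 \<le> 9(M + 1)^2 (N + 1)^2 = N(N + 1)^2 < (N
    + 1)^3\<close>.\<close>
  define N where "N = 9 * (M + 1) ^ 2"
  define I where "I = {..N} \<times> {..N} \<times> {..N}"
  define v where "v = (\<lambda>(i, j, l). P ^ i * F ^ j * G ^ l * D ^ (3 * N - i - j - l))"
  have "3 * N * M + 1 \<le> 3 * (M + 1) * (N + 1)" by (simp add: algebra_simps)
  then have "(3 * N * M + 1) ^ 2 \<le> (3 * (M + 1) * (N + 1)) ^ 2" by (rule power_mono) simp
  also have "\<dots> = N * (N + 1) ^ 2" by (simp add: N_def power2_eq_square algebra_simps)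
  also have "\<dots> < (N + 1) * (N + 1) ^ 2" by simp
  also have "\<dots> = card I" by (simp add: I_def power2_eq_square)
  finally have card: "(3 * N * M + 1) ^ 2 < card I" .
  have "bidegree_le (3 * N * M) (v t)" if t: "t \<in> I" for t
  proof -
    obtain i j l where t': "t = (i, j, l)" by (cases t)
    have "i + j + l + (3 * N - i - j - l) = 3 * N" using t by (auto simp: I_def t')
    then have "i * M + j * M + l * M + (3 * N - i - j - l) * M = 3 * N * M"
      by (metis distrib_right)
    then show ?thesis unfolding t' v_def
      using bidegree_le_mult[OF bidegree_le_mult[OF bidegree_le_mult[OF
          bidegree_le_power[OF M(1), of i] bidegree_le_power[OF M(2), of j]]
          bidegree_le_power[OF M(3), of l]] bidegree_le_power[OF M(4), of "3 * N - i - j - l"]]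
      by simp
  qed
  moreover have "finite I" by (simp add: I_def)
  ultimately obtain c where "\<exists>t\<in>I. c t \<noteq> 0" "(\<Sum>t\<in>I. [:[:c t:]:] * v t) = 0"
    using bidegree_le_dependence[OF _ card, of v] by blast
  then show ?thesis unfolding I_def v_def
    by (intro exI[of _ N] exI[of _ c]) (simp add: case_prod_unfold)
qed

section \<open>Algebraic dependence and independence from rationality\<close>

lemma fract_eq_quotient:
  fixes u :: "'a::idom fract"
  obtains a b where "b \<noteq> 0" "u * to_fract b = to_fract a"
proof (cases u)
  case (Fract a b)
  then have "u * to_fract b = to_fract a" by (simp add: to_fract_def eq_fract)
  with Fract that show thesis by blast
qed

text \<open>The upper bound 2 on the transcendence degree: a common denominator in
  \<open>k(x,y)\<close> reduces the claim to polynomials, and injectivity of \<open>\<phi>\<close>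
  carries the relation back.\<close>

lemma rational2_three_dependent:
  fixes \<iota> :: "'k::field \<Rightarrow> 'b::idom" and p f g :: 'b
  assumes rat: "rational2_over \<iota>"
  shows "\<exists>N c. (\<exists>t\<in>{..N} \<times> {..N} \<times> {..N}. c t \<noteq> 0) \<and>
    (\<Sum>t\<in>{..N} \<times> {..N} \<times> {..N}. case t of (i, j, l) \<Rightarrow> \<iota> (c t) * (p ^ i * f ^ j * g ^ l)) = 0"
proof -
  obtain \<phi> :: "'b fract \<Rightarrow> 'k poly poly fract" where "field_hom \<phi>" "bij \<phi>"
    and \<phi>\<iota>: "\<And>a. \<phi> (to_fract (\<iota> a)) = to_fract [:[:a:]:]"
    using rat unfolding rational2_over_def by blast
  interpret \<phi>: field_hom \<phi> by fact
  define \<psi> where "\<psi> b = \<phi> (to_fract b)" for b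
  obtain P0 D1 where P0: "D1 \<noteq> 0" "\<psi> p * to_fract D1 = to_fract P0" by (rule fract_eq_quotient)
  obtain F0 D2 where F0: "D2 \<noteq> 0" "\<psi> f * to_fract D2 = to_fract F0" by (rule fract_eq_quotient)
  obtain G0 D3 where G0: "D3 \<noteq> 0" "\<psi> g * to_fract D3 = to_fract G0" by (rule fract_eq_quotient)
  \<comment> \<open>\<open>D\<close> is a common denominator of the images of \<open>p\<close>,
    \<open>f\<close>, \<open>g\<close>, with numerators \<open>P\<close>, \<open>F\<close>,
    \<open>G\<close>.\<close>
  define D where "D = D1 * D2 * D3"
  define P where "P = P0 * D2 * D3"
  define F where "F = F0 * D1 * D3"
  define G where "G = G0 * D1 * D2"
  have D: "D \<noteq> 0" using P0 F0 G0 by (simp add: D_def)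
  have PFG: "to_fract P = \<psi> p * to_fract D" "to_fract F = \<psi> f * to_fract D"
    "to_fract G = \<psi> g * to_fract D"
    by (simp_all add: P_def F_def G_def D_def P0(2)[symmetric] F0(2)[symmetric] G0(2)[symmetric]
        mult_ac)
  obtain N c where c: "\<exists>t\<in>{..N} \<times> {..N} \<times> {..N}. c t \<noteq> 0"
    and eq: "(\<Sum>t\<in>{..N} \<times> {..N} \<times> {..N}. case t of (i, j, l) \<Rightarrow>
       [:[:c (i, j, l):]:] * (P ^ i * F ^ j * G ^ l * D ^ (3 * N - i - j - l))) = 0"
    using poly_poly_three_dependent[of P F G D] by (elim exE conjE) (rule that)
  define s where "s = (\<Sum>t\<in>{..N} \<times> {..N} \<times> {..N}. case t of (i, j, l) \<Rightarrow>
      \<iota> (c t) * (p ^ i * f ^ j * g ^ l))"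
  \<comment> \<open>Each of the \<open>3 * N\<close> factors contributes one \<open>D\<close>; the
    subtraction is exact as \<open>i\<close>, \<open>j\<close>, \<open>l\<close> are at most
    \<open>N\<close>.\<close>
  have trm: "to_fract ([:[:c (i, j, l):]:] * (P ^ i * F ^ j * G ^ l * D ^ (3 * N - i - j - l)))
      = \<psi> (\<iota> (c (i, j, l)) * (p ^ i * f ^ j * g ^ l)) * to_fract D ^ (3 * N)"
    if "i \<le> N" "j \<le> N" "l \<le> N" for i j l
  proof -
    have e: "3 * N = i + j + l + (3 * N - i - j - l)" using that by simp
    have "to_fract D ^ (3 * N) = to_fract D ^ i * to_fract D ^ j * to_fract D ^ l
        * to_fract D ^ (3 * N - i - j - l)"
      by (subst e) (simp only: power_add)
    moreover have "\<psi> (\<iota> (c (i, j, l)) * (p ^ i * f ^ j * g ^ l)) =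
        to_fract [:[:c (i, j, l):]:] * (\<psi> p ^ i * \<psi> f ^ j * \<psi> g ^ l)"
      by (simp add: \<psi>_def \<phi>\<iota> \<phi>.hom_mult \<phi>.hom_power to_fract_hom.hom_power)
    ultimately show ?thesis
      unfolding to_fract_hom.hom_mult to_fract_hom.hom_power PFG power_mult_distrib
      by (simp only: mult_ac)
  qed
  have "\<psi> s * to_fract D ^ (3 * N) = (\<Sum>t\<in>{..N} \<times> {..N} \<times> {..N}. case t of (i, j, l) \<Rightarrow>
      \<psi> (\<iota> (c (i, j, l)) * (p ^ i * f ^ j * g ^ l)) * to_fract D ^ (3 * N))"
    unfolding s_def \<psi>_def to_fract_hom.hom_sum \<phi>.hom_sum sum_distrib_right
    by (simp only: case_prod_unfold prod.collapse)
  also have "\<dots> = to_fract (\<Sum>t\<in>{..N} \<times> {..N} \<times> {..N}. case t of (i, j, l) \<Rightarrow>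
       [:[:c (i, j, l):]:] * (P ^ i * F ^ j * G ^ l * D ^ (3 * N - i - j - l)))"
    unfolding to_fract_hom.hom_sum by (rule sum.cong) (auto simp: trm[symmetric])
  finally have "\<psi> s * to_fract D ^ (3 * N) = 0" unfolding eq by simp
  then have "\<psi> s = 0" using D by simp
  then have "s = 0" by (simp add: \<psi>_def)
  with c show ?thesis unfolding s_def by blast
qed

lemma monom_monom_eq_mult:
  "monom (monom c i) j = [:[:c:]:] * ([:[:0, 1:]:] ^ i * [:0, [:1:]:] ^ j)"
proof -
  have "monom (monom c i) j = smult (smult c ([:0, 1:] ^ i)) ([:0, 1:] ^ j)"
    by (simp only: monom_altdef)
  also have "\<dots> = [:[:c:]:] * ([:[:0, 1:] ^ i:] * [:0, 1:] ^ j)" by simp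
  also have "[:0, 1:] = [:0, [:1::'a:]:]" by (simp only: one_pCons)
  finally show ?thesis by (simp only: poly_const_pow)
qed

text \<open>Writing \<open>x = a / d\<close> and \<open>y = b / d\<close> clears denominators by homogenizing.\<close>

lemma rational2_two_independent:
  fixes \<iota> :: "'k::field \<Rightarrow> 'b::idom"
  assumes rat: "rational2_over \<iota>"
  obtains a b d where
    "\<And>N c. (\<Sum>t\<in>{..N} \<times> {..N}. case t of (i, j) \<Rightarrow>
        \<iota> (c t) * (a ^ i * b ^ j * d ^ (2 * N - i - j))) = 0 \<Longrightarrow>
      \<forall>t\<in>{..N} \<times> {..N}. c t = 0"
proof -
  obtain \<phi> :: "'b fract \<Rightarrow> 'k poly poly fract" where "field_hom \<phi>" "bij \<phi>"
    and \<phi>\<iota>: "\<And>a. \<phi> (to_fract (\<iota> a)) = to_fract [:[:a:]:]"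
    using rat unfolding rational2_over_def by blast
  interpret \<phi>: field_hom \<phi> by fact
  define \<psi> where "\<psi> b = \<phi> (to_fract b)" for b
  define X Y where "X = [:[:0, 1::'k:]:]" and "Y = [:0, [:1::'k:]:]"
  \<comment> \<open>Surjectivity of \<open>\<phi>\<close> lifts \<open>x\<close> and
    \<open>y\<close> to fractions \<open>u\<close> and \<open>v\<close>, for which \<open>d\<close>
    below is a common denominator.\<close>
  obtain u v where uv: "to_fract X = \<phi> u" "to_fract Y = \<phi> v"
    using \<open>bij \<phi>\<close> by (metis bij_pointE)
  obtain a0 d1 where a0: "d1 \<noteq> 0" "u * to_fract d1 = to_fract a0" by (rule fract_eq_quotient)
  obtain b0 d2 where b0: "d2 \<noteq> 0" "v * to_fract d2 = to_fract b0" by (rule fract_eq_quotient)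
  define a b d where "a = a0 * d2" and "b = b0 * d1" and "d = d1 * d2"
  have "to_fract a = u * to_fract d" "to_fract b = v * to_fract d"
    by (simp_all add: a_def b_def d_def a0(2)[symmetric] b0(2)[symmetric] mult_ac)
  then have ab: "\<psi> a = to_fract X * \<psi> d" "\<psi> b = to_fract Y * \<psi> d"
    by (simp_all add: \<psi>_def \<phi>.hom_mult uv)
  have d: "\<psi> d \<noteq> 0" using a0(1) b0(1) by (simp add: \<psi>_def d_def)
  show thesis
  proof (rule that)
    fix N and c :: "nat \<times> nat \<Rightarrow> 'k"
    assume eq: "(\<Sum>t\<in>{..N} \<times> {..N}. case t of (i, j) \<Rightarrow>
        \<iota> (c t) * (a ^ i * b ^ j * d ^ (2 * N - i - j))) = 0"
    have trm: "\<psi> (\<iota> (c (i, j)) * (a ^ i * b ^ j * d ^ (2 * N - i - j))) =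
        to_fract (monom (monom (c (i, j)) i) j) * \<psi> d ^ (2 * N)" if "i \<le> N" "j \<le> N" for i j
    proof -
      have e: "2 * N = i + j + (2 * N - i - j)" using that by simp
      have *: "\<psi> d ^ (2 * N) = \<psi> d ^ i * \<psi> d ^ j * \<psi> d ^ (2 * N - i - j)"
        by (subst e) (simp only: power_add)
      have m: "monom (monom (c (i, j)) i) j = [:[:c (i, j):]:] * (X ^ i * Y ^ j)"
        unfolding X_def Y_def by (rule monom_monom_eq_mult)
      have "\<psi> (\<iota> (c (i, j)) * (a ^ i * b ^ j * d ^ (2 * N - i - j))) =
          to_fract [:[:c (i, j):]:] * (\<psi> a ^ i * \<psi> b ^ j * \<psi> d ^ (2 * N - i - j))"
        by (simp add: \<psi>_def \<phi>\<iota> \<phi>.hom_mult \<phi>.hom_power to_fract_hom.hom_power)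
      then show ?thesis
        unfolding m * ab to_fract_hom.hom_mult to_fract_hom.hom_power power_mult_distrib
        by (simp only: mult_ac)
    qed
    \<comment> \<open>Up to the nonzero factor \<open>\<psi> d ^ (2 * N)\<close> the relation says
      that this polynomial in \<open>x\<close> and \<open>y\<close> vanishes; its coefficients are
      the \<open>c (i, j)\<close>.\<close>
    define s where "s = (\<Sum>t\<in>{..N} \<times> {..N}. case t of (i, j) \<Rightarrow> monom (monom (c (i, j)) i) j)"
    have "0 = \<psi> (\<Sum>t\<in>{..N} \<times> {..N}. case t of (i, j) \<Rightarrow>
        \<iota> (c t) * (a ^ i * b ^ j * d ^ (2 * N - i - j)))"
      unfolding eq by (simp add: \<psi>_def)
    also have "\<dots> = (\<Sum>t\<in>{..N} \<times> {..N}. case t of (i, j) \<Rightarrow>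
        \<psi> (\<iota> (c (i, j)) * (a ^ i * b ^ j * d ^ (2 * N - i - j))))"
      unfolding \<psi>_def to_fract_hom.hom_sum \<phi>.hom_sum by (simp only: case_prod_unfold prod.collapse)
    also have "\<dots> = to_fract s * \<psi> d ^ (2 * N)"
      unfolding s_def to_fract_hom.hom_sum sum_distrib_right by (rule sum.cong)
        (auto simp: trm simp del: diff_diff_left)
    finally have "s = 0" using d by simp
    have "c (r, q) = 0" if "r \<le> N" "q \<le> N" for r q
    proof -
      have "0 = coeff (coeff s q) r" using \<open>s = 0\<close> by simp
      also have "\<dots> = (\<Sum>t\<in>{..N} \<times> {..N}. if t = (r, q) then c (r, q) else 0)"
        unfolding s_def coeff_sum by (rule sum.cong) (auto simp: coeff_monom split: if_splits)
      also have "\<dots> = c (r, q)" using that by simp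
      finally show ?thesis by simp
    qed
    then show "\<forall>t\<in>{..N} \<times> {..N}. c t = 0" by auto
  qed
qed

section \<open>The subalgebra generated by a set\<close>

definition monomial_value :: "('b::comm_ring_1 \<Rightarrow>\<^sub>0 nat) \<Rightarrow> 'b" where
  "monomial_value m = (\<Prod>b\<in>Poly_Mapping.keys m. b ^ Poly_Mapping.lookup m b)"

text \<open>Elements outside the support contribute \<open>b ^ 0 = 1\<close>, so two monomials can
  be evaluated over one index set.\<close>

lemma monomial_value_superset:
  assumes "finite S" "Poly_Mapping.keys m \<subseteq> S"
  shows "monomial_value m = (\<Prod>b\<in>S. b ^ Poly_Mapping.lookup m b)"
  unfolding monomial_value_def using assms
  by (intro prod.mono_neutral_left) (auto simp: in_keys_iff)

lemma monomial_value_add: "monomial_value (m + m') = monomial_value m * monomial_value m'"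
proof -
  define S where "S = Poly_Mapping.keys m \<union> Poly_Mapping.keys m'"
  have "finite S" "Poly_Mapping.keys m \<subseteq> S" "Poly_Mapping.keys m' \<subseteq> S"
    "Poly_Mapping.keys (m + m') \<subseteq> S"
    using Poly_Mapping.keys_add[of m m'] by (auto simp: S_def)
  then show ?thesis
    by (simp add: monomial_value_superset[of S] lookup_add power_add prod.distrib)
qed

text \<open>The \<open>k\<close>-subalgebra generated by \<open>S\<close>;
  \<open>affine_over \<iota>\<close> says that it is \<open>UNIV\<close> for some finite
  \<open>S\<close>.\<close>

definition generated :: "('k::comm_ring_1 \<Rightarrow> 'b::comm_ring_1) \<Rightarrow> 'b set \<Rightarrow> 'b set" where
  "generated \<iota> S = poly_value \<iota> ` polys_in S"

context comm_ring_hom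
begin

lemma poly_value_superset:
  assumes "finite M" "Poly_Mapping.keys p \<subseteq> M"
  shows "poly_value hom p = (\<Sum>m\<in>M. hom (Poly_Mapping.lookup p m) * monomial_value m)"
  unfolding poly_value_def monomial_value_def[symmetric] using assms
  by (intro sum.mono_neutral_left) (auto simp: in_keys_iff)

lemma poly_value_add: "poly_value hom (p + q) = poly_value hom p + poly_value hom q"
proof -
  define M where "M = Poly_Mapping.keys p \<union> Poly_Mapping.keys q"
  have "finite M" "Poly_Mapping.keys p \<subseteq> M" "Poly_Mapping.keys q \<subseteq> M"
    "Poly_Mapping.keys (p + q) \<subseteq> M"
    using Poly_Mapping.keys_add[of p q] by (auto simp: M_def)
  then show ?thesis
    by (simp add: poly_value_superset[of M] lookup_add hom_add distrib_right sum.distrib)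
qed

lemma monomial_in_generated:
  assumes "Poly_Mapping.keys m \<subseteq> S"
  shows "hom c * monomial_value m \<in> generated hom S"
proof -
  have "Poly_Mapping.single m c \<in> polys_in S"
    using assms by (auto simp: polys_in_def split: if_splits)
  moreover have "poly_value hom (Poly_Mapping.single m c) = hom c * monomial_value m"
    by (subst poly_value_superset[of "{m}"]) auto
  ultimately show ?thesis unfolding generated_def by (metis imageI)
qed

lemma const_in_generated: "hom c \<in> generated hom S"
  using monomial_in_generated[of 0 S c] by (simp add: monomial_value_def)

lemma generator_in_generated:
  assumes "s \<in> S"
  shows "s \<in> generated hom S"
  using monomial_in_generated[of "Poly_Mapping.single s 1" S 1] assms
  by (simp add: monomial_value_def)

lemma add_in_generated:
  assumes "x \<in> generated hom S" "y \<in> generated hom S"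
  shows "x + y \<in> generated hom S"
proof -
  obtain p q where pq: "p \<in> polys_in S" "q \<in> polys_in S"
    "x = poly_value hom p" "y = poly_value hom q"
    using assms unfolding generated_def by blast
  then have "p + q \<in> polys_in S"
    using Poly_Mapping.keys_add[of p q] unfolding polys_in_def by blast
  with pq show ?thesis unfolding generated_def by (metis imageI poly_value_add)
qed

lemma sum_in_generated:
  assumes "\<And>i. i \<in> I \<Longrightarrow> x i \<in> generated hom S"
  shows "(\<Sum>i\<in>I. x i) \<in> generated hom S"
  using assms
proof (induction I rule: infinite_finite_induct)
  case (insert i I)
  then show ?case by (simp add: add_in_generated)
qed (use const_in_generated[of 0 S] in simp_all)

text \<open>The product of the values is expanded into monomials that lie in the set one by one, so
  no product of formal polynomials is formed.\<close>

lemma mult_in_generated: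
  assumes "x \<in> generated hom S" "y \<in> generated hom S"
  shows "x * y \<in> generated hom S"
proof -
  obtain p q where p: "p \<in> polys_in S" "x = poly_value hom p"
    and q: "q \<in> polys_in S" "y = poly_value hom q"
    using assms unfolding generated_def by blast
  have "x * y = (\<Sum>m\<in>Poly_Mapping.keys p. \<Sum>m'\<in>Poly_Mapping.keys q.
      hom (Poly_Mapping.lookup p m * Poly_Mapping.lookup q m') * monomial_value (m + m'))"
    unfolding p(2) q(2) poly_value_def monomial_value_def[symmetric] sum_product
    by (simp add: monomial_value_add hom_mult mult_ac)
  also have "\<dots> \<in> generated hom S"
  proof (intro sum_in_generated monomial_in_generated)
    fix m m' assume "m \<in> Poly_Mapping.keys p" "m' \<in> Poly_Mapping.keys q"
    then show "Poly_Mapping.keys (m + m') \<subseteq> S"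
      using p(1) q(1) Poly_Mapping.keys_add[of m m'] unfolding polys_in_def by blast
  qed
  finally show ?thesis .
qed

end

section \<open>Factors of monomials in one variable\<close>

lemma order_eq_degree_imp_monom:
  fixes p :: "'a::idom poly"
  assumes "p \<noteq> 0" "Polynomial.order 0 p = degree p"
  shows "p = monom (lead_coeff p) (degree p)"
proof (rule poly_eqI)
  have "\<forall>k<degree p. coeff p k = 0"
    using assms monom_1_dvd_iff[of p "degree p"] monom_1_dvd_iff' by auto
  then show "coeff p k = coeff (monom (lead_coeff p) (degree p)) k" for k
    by (cases k "degree p" rule: linorder_cases) (auto simp: coeff_eq_0)
qed

text \<open>Over a domain the order at 0 and the degree are additive, and both equal
  \<open>n\<close> on the product. Since order never exceeds degree, the two agree on each factor,
  whose lowest and highest exponents thus coincide.\<close>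

lemma mult_eq_monomD:
  fixes p q :: "'a::idom poly"
  assumes "p * q = monom c n" "c \<noteq> 0"
  obtains a b i j where "p = monom a i" "q = monom b j" "i + j = n"
proof -
  have nz: "p * q \<noteq> 0" "p \<noteq> 0" "q \<noteq> 0" using assms by auto
  have "Polynomial.order 0 p + Polynomial.order 0 q = n" using order_mult[OF nz(1), of 0] assms by simp
  moreover have "degree p + degree q = n"
    using degree_mult_eq[OF nz(2,3)] assms by (simp add: degree_monom_eq)
  moreover have "Polynomial.order 0 p \<le> degree p" "Polynomial.order 0 q \<le> degree q"
    using nz by (auto intro: order_degree)
  ultimately have "Polynomial.order 0 p = degree p" "Polynomial.order 0 q = degree q" by linarith+
  then show thesis
    using that order_eq_degree_imp_monom nz \<open>degree p + degree q = n\<close> by metis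
qed

lemma poly_1_superset:
  fixes P :: "'a::comm_ring_1 poly"
  assumes "degree P \<le> n"
  shows "poly P 1 = (\<Sum>i\<le>n. coeff P i)"
proof -
  have "poly P 1 = (\<Sum>i\<le>degree P. coeff P i)" by (simp add: poly_altdef)
  also have "\<dots> = (\<Sum>i\<le>n. coeff P i)"
    using assms by (intro sum.mono_neutral_left) (auto simp: coeff_eq_0)
  finally show ?thesis .
qed

section \<open>Positively graded domains and homogeneous components\<close>

text \<open>
  The decomposition of \<open>b\<close> into homogeneous components \<open>b\<^sub>n \<in> H n\<close> is recorded as the polynomial
  with coefficients \<open>b\<^sub>n\<close>, so that products are graded by polynomial multiplication.
\<close>

locale positively_graded = comm_ring_hom \<iota> for \<iota> :: "'k::field \<Rightarrow> 'b::idom" +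
  fixes H :: "nat \<Rightarrow> 'b set"
  assumes zero_mem: "0 \<in> H n"
    and diff_mem: "x \<in> H n \<Longrightarrow> y \<in> H n \<Longrightarrow> x - y \<in> H n"
    and mult_mem: "x \<in> H i \<Longrightarrow> y \<in> H j \<Longrightarrow> x * y \<in> H (i + j)"
    and degree_0: "H 0 = range \<iota>"
    and decomposition: "\<exists>!P. (\<forall>n. coeff P n \<in> H n) \<and> poly P 1 = b"
begin

definition components :: "'b \<Rightarrow> 'b poly" where
  "components b = (THE P. (\<forall>n. coeff P n \<in> H n) \<and> poly P 1 = b)"

lemma coeff_components_mem: "coeff (components b) n \<in> H n"
  and poly_components: "poly (components b) 1 = b"
  using theI'[OF decomposition[of b]] unfolding components_def by blast+

lemma components_eqI: "(\<And>n. coeff P n \<in> H n) \<Longrightarrow> poly P 1 = b \<Longrightarrow> components b = P"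
  using decomposition[of b] coeff_components_mem[of b] poly_components[of b] by blast

lemma add_mem: "x \<in> H n \<Longrightarrow> y \<in> H n \<Longrightarrow> x + y \<in> H n"
  using diff_mem[of x n "0 - y"] diff_mem[of 0 n y] zero_mem by simp

lemma sum_mem: "(\<And>i. i \<in> I \<Longrightarrow> x i \<in> H n) \<Longrightarrow> (\<Sum>i\<in>I. x i) \<in> H n"
  by (induction I rule: infinite_finite_induct) (auto simp: zero_mem add_mem)

lemma scale_mem: "x \<in> H n \<Longrightarrow> \<iota> c * x \<in> H n"
  using mult_mem[of "\<iota> c" 0 x n] degree_0 by auto

lemma power_mem: "x \<in> H n \<Longrightarrow> x ^ i \<in> H (i * n)"
proof (induction i)
  case 0
  show ?case using degree_0 hom_one by (metis mult_zero_left power_0 rangeI)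
next
  case (Suc i)
  then show ?case using mult_mem[of x n "x ^ i" "i * n"] by simp
qed

lemma unit_hom: "c \<noteq> 0 \<Longrightarrow> \<iota> c dvd 1"
  by (rule dvdI[of _ _ "\<iota> (inverse c)"]) (simp flip: hom_mult)

lemma hom_eq_0_iff: "\<iota> c = 0 \<longleftrightarrow> c = 0"
  using unit_hom[of c] by (cases "c = 0") auto

text \<open>Evaluation at 1 is multiplicative and the product polynomial has its coefficients in the
  right \<open>H n\<close>, so uniqueness of the decomposition applies.\<close>

lemma components_mult: "components (x * y) = components x * components y"
proof (rule components_eqI)
  fix n
  have "coeff (components x) i * coeff (components y) (n - i) \<in> H n" if "i \<le> n" for i
    using mult_mem[OF coeff_components_mem[of x i] coeff_components_mem[of y "n - i"]] that
    by simp
  then show "coeff (components x * components y) n \<in> H n"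
    unfolding coeff_mult by (intro sum_mem) auto
qed (simp add: poly_components)

lemma components_homogeneous: "x \<in> H n \<Longrightarrow> components x = monom x n"
  by (rule components_eqI) (auto simp: zero_mem poly_monom)

lemma homogeneous_iff: "x \<in> H n \<longleftrightarrow> components x = monom x n"
  using coeff_components_mem[of x n] components_homogeneous by auto

lemma components_power: "components (x ^ n) = components x ^ n"
proof (induction n)
  case 0
  have "1 \<in> H 0" using degree_0 hom_one by (metis rangeI)
  then show ?case using components_homogeneous by simp
qed (simp add: components_mult)

text \<open>The component polynomials of \<open>x\<close> and \<open>y\<close> multiply to a
  monomial, so each is itself a monomial.\<close>

lemma homogeneous_factors:
  assumes "x * y \<in> H n" "x * y \<noteq> 0"
  obtains i j where "x \<in> H i" "y \<in> H j" "i + j = n"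
proof -
  have "components x * components y = monom (x * y) n"
    using assms components_homogeneous components_mult by metis
  then obtain a b i j where ab: "components x = monom a i" "components y = monom b j" "i + j = n"
    using assms(2) by (rule mult_eq_monomD)
  then have "x = a" "y = b" using poly_components[of x] poly_components[of y]
    by (simp_all add: poly_monom)
  with ab that show thesis by (simp add: homogeneous_iff)
qed

text \<open>Grouped by weight, the summands form a decomposition of \<open>0\<close>, whose
  components vanish by uniqueness.\<close>

lemma homogeneous_parts_eq_0:
  assumes T: "finite T" and v: "\<And>t. t \<in> T \<Longrightarrow> v t \<in> H (wt t)" and 0: "(\<Sum>t\<in>T. v t) = 0"
  shows "(\<Sum>t\<in>{t \<in> T. wt t = m}. v t) = 0"
proof -
  define P where "P = (\<Sum>t\<in>T. monom (v t) (wt t))"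
  have "components 0 = P"
  proof (rule components_eqI)
    show "coeff P n \<in> H n" for n
      unfolding P_def coeff_sum by (rule sum_mem) (auto simp: v zero_mem)
    show "poly P 1 = 0" using 0 by (simp add: P_def poly_sum poly_monom)
  qed
  moreover have "components 0 = 0" by (rule components_eqI) (auto simp: zero_mem)
  ultimately have "0 = coeff P m" by simp
  also have "\<dots> = (\<Sum>t\<in>T. if wt t = m then v t else 0)"
    unfolding P_def coeff_sum by (rule sum.cong) auto
  also have "\<dots> = (\<Sum>t\<in>{t \<in> T. wt t = m}. v t)" using T by (simp add: sum.inter_filter)
  finally show ?thesis by simp
qed

text \<open>The dimension of \<open>H n\<close> is at most 1; \<open>w = 0\<close> covers the zero
  space.\<close>

definition thin :: "nat \<Rightarrow> bool" where
  "thin n \<longleftrightarrow> (\<exists>w\<in>H n. \<forall>x\<in>H n. \<exists>c. x = \<iota> c * w)"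

lemma thin_0: "thin 0"
  unfolding thin_def degree_0 by (rule bexI[of _ 1]) (auto intro: range_eqI[of _ _ 1])

text \<open>
  The \<open>(N + 1)\<^sup>2\<close> monomials \<open>a\<^sup>i b\<^sup>j d\<^sup>2\<^sup>N\<^sup>-\<^sup>i\<^sup>-\<^sup>j\<close> have degree at most \<open>2NM\<close>, hence lie in a space
  whose dimension grows only linearly with \<open>N\<close>.
\<close>

lemma all_thin_dependent:
  assumes thin: "\<And>n. thin n"
  shows "\<exists>N c. (\<exists>t\<in>{..N} \<times> {..N}. c t \<noteq> 0) \<and>
    (\<Sum>t\<in>{..N} \<times> {..N}. case t of (i, j) \<Rightarrow> \<iota> (c t) * (a ^ i * b ^ j * d ^ (2 * N - i - j))) = 0"
proof -
  define M where "M = degree (components a) + degree (components b) + degree (components d)"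
  \<comment> \<open>As \<open>2 * M = N - 1\<close>, the dimension bound is
    \<open>2NM + 1 = N^2 - N + 1 < (N + 1)^2\<close>.\<close>
  define N where "N = 2 * M + 1"
  define I where "I = {..N} \<times> {..N}"
  define v where "v = (\<lambda>(i, j). a ^ i * b ^ j * d ^ (2 * N - i - j))"
  have "\<exists>w. \<forall>x\<in>H n. \<exists>c. x = \<iota> c * w" for n using thin unfolding thin_def by blast
  then obtain w where w: "\<And>n x. x \<in> H n \<Longrightarrow> \<exists>c. x = \<iota> c * w n" by metis
  then have "\<exists>\<alpha>. coeff (components (v t)) n = \<iota> \<alpha> * w n" for t n
    using coeff_components_mem by blast
  then obtain \<alpha> where \<alpha>: "\<And>t n. coeff (components (v t)) n = \<iota> (\<alpha> t n) * w n" by metis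
  have "v t = (\<Sum>n\<in>{..2 * N * M}. \<iota> (\<alpha> t n) * w n)" if t: "t \<in> I" for t
  proof -
    obtain i j where t': "t = (i, j)" by (cases t)
    have "degree (components (v t)) \<le>
        degree (components a ^ i) + degree (components b ^ j) + degree (components d ^ (2 * N - i - j))"
      unfolding t' v_def prod.case components_mult components_power
      by (meson add_le_mono degree_mult_le order_refl order_trans)
    also have "\<dots> \<le> i * M + j * M + (2 * N - i - j) * M"
      by (intro add_mono order_trans[OF degree_power_le]) (auto simp: M_def algebra_simps)
    also have "\<dots> = 2 * N * M"
    proof -
      have "i + j + (2 * N - i - j) = 2 * N" using t by (auto simp: I_def t')
      then show ?thesis by (metis distrib_right)
    qed
    finally show ?thesis
      using poly_components[of "v t"] by (simp add: poly_1_superset \<alpha>)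
  qed
  moreover have "card {..2 * N * M} < card I"
    by (simp add: I_def N_def algebra_simps)
  moreover have "finite I" by (simp add: I_def)
  ultimately obtain c where "\<exists>t\<in>I. c t \<noteq> 0" "(\<Sum>t\<in>I. \<iota> (c t) * v t) = 0"
    using linear_dependence_in_span[OF comm_ring_hom_axioms finite_atMost, of I "2 * N * M" v \<alpha> w]
    by blast
  then show ?thesis unfolding I_def v_def
    by (intro exI[of _ N] exI[of _ c]) (simp add: case_prod_unfold)
qed

section \<open>Binary forms in two homogeneous elements\<close>

text \<open>The homogenization of \<open>P\<close> to degree \<open>e\<close>, evaluated at
  \<open>f\<close> and \<open>g\<close>. The degree \<open>e\<close> is a separate argument because
  it may exceed \<open>degree P\<close>; powers of \<open>g\<close> then split off.\<close>

definition form :: "'b \<Rightarrow> 'b \<Rightarrow> nat \<Rightarrow> 'k poly \<Rightarrow> 'b" where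
  "form f g e P = (\<Sum>s\<le>e. \<iota> (coeff P s) * (f ^ s * g ^ (e - s)))"

text \<open>Multiplying by the variable shifts coefficients, which becomes multiplication by
  \<open>f\<close>; in the part with \<open>\<mu>\<close> the coefficient of index
  \<open>Suc e\<close> vanishes by the degree bound and a factor \<open>g\<close> comes out.\<close>

lemma form_linear_factor:
  assumes "degree Q \<le> e"
  shows "form f g (Suc e) ([:- \<mu>, 1:] * Q) = (f - \<iota> \<mu> * g) * form f g e Q"
proof -
  have c: "coeff ([:- \<mu>, 1:] * Q) s = (case s of 0 \<Rightarrow> 0 | Suc r \<Rightarrow> coeff Q r) - \<mu> * coeff Q s" for s
    by (simp add: coeff_pCons split: nat.split)
  have "(\<Sum>s\<le>Suc e. \<iota> (case s of 0 \<Rightarrow> 0 | Suc r \<Rightarrow> coeff Q r) * (f ^ s * g ^ (Suc e - s))) =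
      f * form f g e Q"
    unfolding form_def sum_distrib_left sum.atMost_Suc_shift by (simp add: mult_ac)
  moreover have "(\<Sum>s\<le>Suc e. \<iota> (\<mu> * coeff Q s) * (f ^ s * g ^ (Suc e - s))) =
      \<iota> \<mu> * g * form f g e Q"
    using assms
    by (simp add: form_def sum_distrib_left coeff_eq_0 hom_mult Suc_diff_le mult_ac)
  ultimately show ?thesis
    unfolding form_def[of f g "Suc e"] c hom_minus left_diff_distrib sum_subtractf by simp
qed

text \<open>
  Take one homogeneous part of the relation and cancel the least power of \<open>p\<close> in it: what remains
  free of \<open>p\<close> is a form in \<open>f\<close> and \<open>g\<close>, because the weight of \<open>p\<^sup>i f\<^sup>j g\<^sup>l\<close> and \<open>i\<close>
  determine \<open>j + l\<close>.
\<close>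

lemma prime_dvd_form:
  assumes f: "f \<in> H n" and g: "g \<in> H n" and n: "n > 0" and p: "p \<in> H d" "p \<noteq> 0"
    and c: "\<exists>t\<in>{..N} \<times> {..N} \<times> {..N}. c t \<noteq> 0"
    and rel: "(\<Sum>t\<in>{..N} \<times> {..N} \<times> {..N}. case t of (i, j, l) \<Rightarrow>
      \<iota> (c t) * (p ^ i * f ^ j * g ^ l)) = 0"
  shows "\<exists>e P. P \<noteq> 0 \<and> degree P \<le> e \<and> p dvd form f g e P"
proof -
  define T where "T = {..N} \<times> {..N} \<times> {..N}"
  define v where "v = (\<lambda>(i, j, l). \<iota> (c (i, j, l)) * (p ^ i * f ^ j * g ^ l))"
  define wt where "wt = (\<lambda>(i, j, l). i * d + j * n + l * n)"
  have "finite T" by (simp add: T_def)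
  have "v t \<in> H (wt t)" for t
    unfolding v_def wt_def
    by (auto split: prod.split intro!: scale_mem mult_mem power_mem p f g)
  moreover have "(\<Sum>t\<in>T. v t) = 0" using rel by (simp add: T_def v_def case_prod_unfold)
  ultimately have part: "(\<Sum>t\<in>{t \<in> T. wt t = m}. v t) = 0" for m
    using homogeneous_parts_eq_0[of T v wt m] \<open>finite T\<close> by blast
  obtain t0 where t0: "t0 \<in> T" "c t0 \<noteq> 0" using c by (auto simp: T_def)
  \<comment> \<open>Zero coefficients are dropped, so that the least exponent \<open>i1\<close>
    belongs to a term that is really present.\<close>
  define T0 where "T0 = {t \<in> T. wt t = wt t0 \<and> c t \<noteq> 0}"
  have T0: "finite T0" "t0 \<in> T0" using t0 \<open>finite T\<close> by (auto simp: T0_def)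
  have sum0: "(\<Sum>t\<in>T0. v t) = 0"
    unfolding part[of "wt t0", symmetric] T0_def using \<open>finite T\<close>
    by (intro sum.mono_neutral_left) (auto simp: v_def)
  define i1 where "i1 = Min (fst ` T0)"
  have i1_min: "i1 \<le> fst t" if "t \<in> T0" for t using that T0 by (auto simp: i1_def)
  have "i1 \<in> fst ` T0" unfolding i1_def using T0 by (intro Min_in) auto
  then obtain j1 l1 where t1: "(i1, j1, l1) \<in> T0" by force
  define T1 where "T1 = {t \<in> T0. fst t = i1}"
  have T1: "finite T1" "T1 \<subseteq> T0" using T0 by (auto simp: T1_def)
  define e where "e = j1 + l1"
  have e: "j + l = e" if "(i, j, l) \<in> T1" for i j l
  proof -
    have "wt (i1, j, l) = wt (i1, j1, l1)" using that t1 by (auto simp: T1_def T0_def)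
    then have "(j + l) * n = e * n" by (simp add: wt_def e_def algebra_simps)
    then show ?thesis using n by simp
  qed
  \<comment> \<open>On \<open>T1\<close> the exponents of \<open>f\<close> and \<open>g\<close> add
    up to \<open>e\<close>, so distinct terms have distinct exponents of \<open>f\<close> and none
    of them cancel in \<open>P\<close>.\<close>
  define P where "P = (\<Sum>t\<in>T1. monom (c t) (fst (snd t)))"
  have form_P: "form f g e P = (\<Sum>(i, j, l)\<in>T1. \<iota> (c (i, j, l)) * (f ^ j * g ^ l))"
  proof -
    have "form f g e P =
        (\<Sum>s\<le>e. \<Sum>t\<in>T1. if fst (snd t) = s then \<iota> (c t) * (f ^ s * g ^ (e - s)) else 0)"
      unfolding form_def P_def coeff_sum hom_sum sum_distrib_right
      by (intro sum.cong refl) auto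
    also have "\<dots> = (\<Sum>t\<in>T1. \<Sum>s\<le>e. if s = fst (snd t) then \<iota> (c t) * (f ^ s * g ^ (e - s)) else 0)"
      by (subst sum.swap) (simp add: eq_commute)
    also have "\<dots> = (\<Sum>(i, j, l)\<in>T1. \<iota> (c (i, j, l)) * (f ^ j * g ^ l))"
      by (intro sum.cong refl) (auto simp: e[symmetric])
    finally show ?thesis .
  qed
  have "coeff P j1 = (\<Sum>t\<in>T1. if t = (i1, j1, l1) then c t else 0)"
    unfolding P_def coeff_sum
  proof (intro sum.cong refl)
    fix t assume "t \<in> T1"
    then obtain j l where t: "t = (i1, j, l)" "j + l = e" using e by (cases t) (auto simp: T1_def)
    then show "coeff (monom (c t) (fst (snd t))) j1 = (if t = (i1, j1, l1) then c t else 0)"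
      by (auto simp: e_def)
  qed
  also have "\<dots> = c (i1, j1, l1)" using T1 t1 by (simp add: T1_def)
  also have "\<dots> \<noteq> 0" using t1 by (simp add: T0_def)
  finally have "P \<noteq> 0" by auto
  moreover have "degree P \<le> e"
    unfolding P_def
    by (intro degree_sum_le T1 order_trans[OF degree_monom_le]) (use e in force)
  moreover have "p dvd form f g e P"
  proof -
    have "(\<Sum>t\<in>T0. v t) = (\<Sum>t\<in>T1. v t) + (\<Sum>t\<in>T0 - T1. v t)"
      using T0 T1 by (simp add: sum.subset_diff add.commute)
    moreover have "(\<Sum>t\<in>T1. v t) = p ^ i1 * form f g e P"
      unfolding form_P sum_distrib_left
      by (intro sum.cong refl) (auto simp: T1_def v_def mult_ac)
    moreover have "p ^ Suc i1 dvd (\<Sum>t\<in>T0 - T1. v t)"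
    proof (rule dvd_sum)
      fix t assume t: "t \<in> T0 - T1"
      obtain i j l where t': "t = (i, j, l)" by (cases t)
      have "Suc i1 \<le> i" using t i1_min[of t] by (auto simp: T1_def t')
      then have "p ^ Suc i1 dvd p ^ i" by (rule le_imp_power_dvd)
      then show "p ^ Suc i1 dvd v t"
        unfolding t' v_def prod.case by (intro dvd_mult dvd_mult2)
    qed
    ultimately have "p ^ i1 * p dvd p ^ i1 * form f g e P"
      using sum0 by (metis add_eq_0_iff dvd_minus_iff mult.commute power_Suc)
    then show ?thesis using p(2) by simp
  qed
  ultimately show ?thesis by blast
qed

end

text \<open>Induction on \<open>e\<close>: a factor \<open>g\<close> splits off if \<open>P\<close>
  has degree below the form's, and a root of \<open>P\<close> gives a linear factor otherwise; the
  prime divides this factor or the remaining form. In degree 0 the form is a unit.\<close>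

lemma (in positively_graded) prime_dvd_formD:
  fixes P :: "'k poly"
  assumes alg_closed: "\<And>P :: 'k poly. degree P > 0 \<Longrightarrow> \<exists>x. poly P x = 0"
    and p: "prime_elem p" and "P \<noteq> 0" "degree P \<le> e" "p dvd form f g e P"
  shows "p dvd g \<or> (\<exists>\<mu>. p dvd f - \<iota> \<mu> * g)"
  using assms(3-)
proof (induction e arbitrary: P)
  case 0
  then obtain a where "P = [:a:]" "a \<noteq> 0" by (metis degree_eq_zeroE le_zero_eq pCons_0_0)
  then have "p dvd \<iota> a" "\<iota> a dvd 1" using 0 unit_hom by (auto simp: form_def)
  then have "p dvd 1" by (rule dvd_trans)
  then show ?case using p by (simp add: prime_elem_def)
next
  case (Suc e)
  show ?case
  proof (cases "degree P \<le> e")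
    case True
    have "form f g (Suc e) P = g * form f g e P"
      using True by (simp add: form_def coeff_eq_0 sum_distrib_left Suc_diff_le mult_ac)
    with Suc.prems have "p dvd g \<or> p dvd form f g e P" using p prime_elem_dvd_multD by metis
    then show ?thesis using Suc.IH[OF Suc.prems(1) True] by blast
  next
    case False
    then have deg: "degree P = Suc e" using Suc.prems by simp
    then obtain \<mu> where "poly P \<mu> = 0" using alg_closed by force
    then obtain Q where Q: "P = [:- \<mu>, 1:] * Q" by (auto simp: poly_eq_0_iff_dvd)
    then have "Q \<noteq> 0" using Suc.prems by auto
    then have "degree Q = e" using deg unfolding Q by (subst (asm) degree_mult_eq) auto
    then have "p dvd (f - \<iota> \<mu> * g) * form f g e Q"
      using Suc.prems(3) form_linear_factor[of Q e] by (simp add: Q del: mult_pCons_left)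
    then have "p dvd f - \<iota> \<mu> * g \<or> p dvd form f g e Q"
      by (rule prime_elem_dvd_multD[OF p])
    then show ?thesis using Suc.IH[of Q] \<open>Q \<noteq> 0\<close> \<open>degree Q = e\<close> by auto
  qed
qed

section \<open>Finite generation\<close>

text \<open>It suffices to reach homogeneous elements, and by induction on the degree homogeneous
  irreducibles. These are prime in a UFD, so they divide a linear form in \<open>f\<close> and
  \<open>g\<close>.\<close>

theorem graded_rational_ufd_affine:
  fixes \<iota> :: "'k::alg_closed_field \<Rightarrow> 'b::ufd"
  assumes "positively_graded \<iota> H" and rat: "rational2_over \<iota>"
  shows "affine_over \<iota>"
proof -
  interpret positively_graded \<iota> H by fact
  \<comment> \<open>If all degrees were thin, \<open>all_thin_dependent\<close> would contradict the
    independence of the monomials in \<open>a\<close>, \<open>b\<close>, \<open>d\<close>.\<close>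
  obtain n0 where "\<not> thin n0"
  proof (rule ccontr)
    assume "\<not> thesis"
    then have "thin n" for n using that by blast
    moreover obtain a b d where "\<And>N c. (\<Sum>t\<in>{..N} \<times> {..N}. case t of (i, j) \<Rightarrow>
        \<iota> (c t) * (a ^ i * b ^ j * d ^ (2 * N - i - j))) = 0 \<Longrightarrow> \<forall>t\<in>{..N} \<times> {..N}. c t = 0"
      using rational2_two_independent[OF rat] by blast
    ultimately show False using all_thin_dependent[of a b d] by blast
  qed
  define n where "n = (LEAST n. \<not> thin n)"
  have "\<not> thin n" unfolding n_def using \<open>\<not> thin n0\<close> by (rule LeastI)
  have thin: "thin m" if "m < n" for m using that not_less_Least unfolding n_def by blast
  have "n > 0" using \<open>\<not> thin n\<close> thin_0 by (cases n) auto
  \<comment> \<open>If \<open>H n\<close> were zero, \<open>0\<close> would witness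
    \<open>thin n\<close>; if every element were a multiple of \<open>g\<close>, then
    \<open>g\<close> would.\<close>
  obtain g where g: "g \<in> H n" "g \<noteq> 0"
    using \<open>\<not> thin n\<close> zero_mem unfolding thin_def by (metis mult_zero_right)
  obtain f where f: "f \<in> H n" "\<And>c. f \<noteq> \<iota> c * g"
    using \<open>\<not> thin n\<close> g(1) unfolding thin_def by blast
  have "\<exists>w. \<forall>x\<in>H m. \<exists>c. x = \<iota> c * w" if "m < n" for m using thin[OF that] unfolding thin_def by blast
  then obtain w where w: "\<And>m x. m < n \<Longrightarrow> x \<in> H m \<Longrightarrow> \<exists>c. x = \<iota> c * w m" by metis
  define S where "S = {f, g} \<union> w ` {..<n}"
  let ?A = "generated \<iota> S"
  have fg_mem: "f \<in> ?A" "g \<in> ?A" by (simp_all add: generator_in_generated S_def)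
  have w_mem: "w m \<in> ?A" if "m < n" for m using that by (simp add: generator_in_generated S_def)
  have low: "x \<in> ?A" if "m < n" "x \<in> H m" for x m
    using w[OF that] w_mem[OF that(1)] mult_in_generated const_in_generated by blast
  have prime: "p \<in> ?A" if p: "prime_elem p" "p \<in> H m" for p m
  proof -
    have "p \<noteq> 0" using p by auto
    obtain N c where rel: "\<exists>t\<in>{..N} \<times> {..N} \<times> {..N}. c t \<noteq> 0"
      "(\<Sum>t\<in>{..N} \<times> {..N} \<times> {..N}. case t of (i, j, l) \<Rightarrow> \<iota> (c t) * (p ^ i * f ^ j * g ^ l)) = 0"
      using rational2_three_dependent[OF rat, of p f g] by (elim exE conjE) (rule that)
    obtain e P where "P \<noteq> 0" "degree P \<le> e" "p dvd form f g e P"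
      using prime_dvd_form[OF f(1) g(1) \<open>n > 0\<close> p(2) \<open>p \<noteq> 0\<close> rel] by blast
    then have "p dvd g \<or> (\<exists>\<mu>. p dvd f - \<iota> \<mu> * g)"
      using prime_dvd_formD[OF _ p(1), of P e f g] alg_closed_imp_poly_has_root by blast
    \<comment> \<open>\<open>L\<close> is \<open>g\<close> or \<open>f - \<iota> \<mu> * g\<close>,
      which is nonzero because \<open>f\<close> is not a multiple of \<open>g\<close>.\<close>
    then obtain L where L: "p dvd L" "L \<in> H n" "L \<noteq> 0" "L \<in> ?A"
    proof (elim disjE exE)
      assume "p dvd g"
      with g fg_mem that show thesis by blast
    next
      fix \<mu> assume *: "p dvd f - \<iota> \<mu> * g"
      have "f - \<iota> \<mu> * g = f + \<iota> (- \<mu>) * g" by (simp add: hom_uminus)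
      also have "\<dots> \<in> ?A"
        by (intro add_in_generated mult_in_generated const_in_generated fg_mem)
      finally have "f - \<iota> \<mu> * g \<in> ?A" .
      moreover have "f - \<iota> \<mu> * g \<in> H n" using f g by (intro diff_mem scale_mem)
      ultimately show thesis using that * f(2)[of \<mu>] by auto
    qed
    then obtain h where h: "L = p * h" by blast
    then obtain i j where ij: "p \<in> H i" "h \<in> H j" "i + j = n"
      using L homogeneous_factors by metis
    show "p \<in> ?A"
    proof (cases "i < n")
      case True
      then show ?thesis using low ij(1) by blast
    next
      case False
      then have "j = 0" using ij(3) by simp
      then have "h \<in> range \<iota>" using ij(2) degree_0 by blast
      then obtain a where a: "h = \<iota> a" by blast
      have "a \<noteq> 0" using L(3) h a by auto
      then have "p = \<iota> (inverse a) * L" by (simp add: h a mult.left_commute flip: hom_mult)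
      then show ?thesis using L(4) mult_in_generated const_in_generated by metis
    qed
  qed
  have homogeneous: "x \<in> ?A" if "x \<in> H m" for x m
    using that
  proof (induction m arbitrary: x rule: less_induct)
    case (less m)
    show ?case
    proof (cases "x \<in> range \<iota>")
      case True
      then show ?thesis using const_in_generated by blast
    next
      case False
      then have "x \<noteq> 0" using hom_zero by (metis rangeI)
      \<comment> \<open>An inverse of \<open>x\<close> would be homogeneous of degree at least 0,
        which puts \<open>x\<close> into \<open>H 0 = range \<iota>\<close>.\<close>
      have nonunit: "\<not> x dvd 1"
      proof
        assume "x dvd 1"
        then obtain y where "1 = x * y" by blast
        moreover have "1 \<in> H 0" using degree_0 hom_one by (metis rangeI)
        ultimately obtain i j where "x \<in> H i" "i + j = 0"
          using homogeneous_factors[of x y 0] by auto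
        with False degree_0 show False by simp
      qed
      show ?thesis
      proof (cases "irreducible x")
        case True
        then have "prime_elem x" by simp
        then show ?thesis using less.prems by (rule prime)
      next
        case False
        then obtain y z where yz: "x = y * z" "\<not> y dvd 1" "\<not> z dvd 1"
          using irreducibleI[OF \<open>x \<noteq> 0\<close> nonunit] by blast
        then obtain i j where ij: "y \<in> H i" "z \<in> H j" "i + j = m"
          using \<open>x \<noteq> 0\<close> less.prems homogeneous_factors by metis
        \<comment> \<open>Nonzero elements of degree 0 are units, so the nonunits \<open>y\<close>
          and \<open>z\<close> have positive degrees, and both degrees are less than
          \<open>m\<close>.\<close>
        have "u dvd 1" if "u \<in> H 0" "u \<noteq> 0" for u using that degree_0 unit_hom
          by (auto simp: hom_eq_0_iff)
        then have "i > 0" "j > 0" using ij yz \<open>x \<noteq> 0\<close> by (auto intro!: Nat.gr0I)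
        then have "y \<in> ?A" "z \<in> ?A"
          using less.IH[of i y] less.IH[of j z] ij by simp_all
        then show ?thesis unfolding yz(1) by (rule mult_in_generated)
      qed
    qed
  qed
  have "b \<in> ?A" for b
  proof -
    have "b = (\<Sum>i\<le>degree (components b). coeff (components b) i)"
      using poly_1_superset[of "components b" "degree (components b)"] poly_components[of b] by simp
    also have "\<dots> \<in> ?A" by (intro sum_in_generated homogeneous[OF coeff_components_mem])
    finally show ?thesis .
  qed
  then have "poly_value \<iota> ` polys_in S = UNIV" unfolding generated_def by blast
  moreover have "finite S" by (simp add: S_def)
  ultimately show ?thesis unfolding affine_over_def by blast
qed

section \<open>From integer gradings to the polynomial encoding\<close>

text \<open>The pieces of negative degree are zero, so finitely supported families over the integers
  correspond to polynomials.\<close>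

lemma positive_grading_imp_positively_graded:
  fixes \<iota> :: "'k::field \<Rightarrow> 'b::idom"
  assumes hom: "comm_ring_hom \<iota>" and B: "positive_grading_over \<iota> B"
  shows "positively_graded \<iota> (\<lambda>n. B (int n))"
proof -
  have zero: "0 \<in> B i" and diff: "x \<in> B i \<Longrightarrow> y \<in> B i \<Longrightarrow> x - y \<in> B i"
    and mult: "x \<in> B i \<Longrightarrow> y \<in> B j \<Longrightarrow> x * y \<in> B (i + j)"
    and neg: "i < 0 \<Longrightarrow> B i = {0}" and B0: "B 0 = range \<iota>" for x y i j
    using B unfolding positive_grading_over_def int_grading_over_def by blast+
  have decomp: "\<exists>!f :: int \<Rightarrow>\<^sub>0 'b. (\<forall>i. Poly_Mapping.lookup f i \<in> B i) \<and>
        (\<Sum>i\<in>Poly_Mapping.keys f. Poly_Mapping.lookup f i) = b" for b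
    using B[unfolded positive_grading_over_def int_grading_over_def,
        THEN conjunct1, THEN conjunct2, THEN conjunct1, THEN spec] .
  have "\<exists>!P. (\<forall>n. coeff P n \<in> B (int n)) \<and> poly P 1 = b" for b
  proof (rule ex_ex1I)
    obtain f :: "int \<Rightarrow>\<^sub>0 'b" where f: "\<And>i. Poly_Mapping.lookup f i \<in> B i"
      "(\<Sum>i\<in>Poly_Mapping.keys f. Poly_Mapping.lookup f i) = b"
      using decomp[of b] by blast
    have nonneg: "0 \<le> i" if "i \<in> Poly_Mapping.keys f" for i
      using that f(1)[of i] neg[of i] by (force simp: in_keys_iff)
    define P where "P = (\<Sum>i\<in>Poly_Mapping.keys f. monom (Poly_Mapping.lookup f i) (nat i))"
    have "coeff P n = Poly_Mapping.lookup f (int n)" for n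
    proof -
      have "coeff P n = (\<Sum>i\<in>Poly_Mapping.keys f. if i = int n then Poly_Mapping.lookup f i else 0)"
        unfolding P_def coeff_sum using nonneg by (intro sum.cong refl) auto
      then show ?thesis by (simp add: in_keys_iff)
    qed
    moreover have "poly P 1 = b" using f(2) by (simp add: P_def poly_sum poly_monom)
    ultimately show "\<exists>P. (\<forall>n. coeff P n \<in> B (int n)) \<and> poly P 1 = b" using f(1) by metis
  next
    fix P Q assume P: "(\<forall>n. coeff P n \<in> B (int n)) \<and> poly P 1 = b"
      and Q: "(\<forall>n. coeff Q n \<in> B (int n)) \<and> poly Q 1 = b"
    \<comment> \<open>\<open>F R\<close> extends the coefficients of \<open>R\<close> by zero to
      negative degrees, so the uniqueness of integer-indexed families forces
      \<open>P = Q\<close>.\<close>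
    define F where "F R = Abs_poly_mapping (\<lambda>i. if i < 0 then 0 else coeff R (nat i))"
      for R :: "'b poly"
    have F: "Poly_Mapping.lookup (F R) i = (if i < 0 then 0 else coeff R (nat i))" for R i
    proof -
      have "{i. (if i < 0 then 0 else coeff R (nat i)) \<noteq> 0} \<subseteq> {0..int (degree R)}"
        by (auto split: if_splits dest!: le_degree)
      then have "finite {i. (if i < 0 then 0 else coeff R (nat i)) \<noteq> 0}"
        by (rule finite_subset) simp
      then show ?thesis unfolding F_def by simp
    qed
    have "(\<forall>i. Poly_Mapping.lookup (F R) i \<in> B i) \<and>
        (\<Sum>i\<in>Poly_Mapping.keys (F R). Poly_Mapping.lookup (F R) i) = b"
      if R: "(\<forall>n. coeff R n \<in> B (int n)) \<and> poly R 1 = b" for R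
    proof
      show "\<forall>i. Poly_Mapping.lookup (F R) i \<in> B i"
        using R zero unfolding F by (metis nat_0_le not_less)
      have keys: "Poly_Mapping.keys (F R) \<subseteq> int ` {..degree R}"
      proof
        fix i assume "i \<in> Poly_Mapping.keys (F R)"
        then have "0 \<le> i" "coeff R (nat i) \<noteq> 0" by (auto simp: in_keys_iff F split: if_splits)
        then show "i \<in> int ` {..degree R}" using le_degree by (intro image_eqI[of _ _ "nat i"]) auto
      qed
      have "(\<Sum>i\<in>Poly_Mapping.keys (F R). Poly_Mapping.lookup (F R) i) =
          (\<Sum>i\<in>int ` {..degree R}. Poly_Mapping.lookup (F R) i)"
        using keys by (intro sum.mono_neutral_left) (auto simp: in_keys_iff)
      also have "\<dots> = (\<Sum>n\<le>degree R. coeff R n)"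
        by (subst sum.reindex) (auto simp: F inj_on_def)
      also have "\<dots> = b" using R poly_1_superset[of R "degree R"] by simp
      finally show "(\<Sum>i\<in>Poly_Mapping.keys (F R). Poly_Mapping.lookup (F R) i) = b" .
    qed
    from this[OF P] this[OF Q] have "F P = F Q" using decomp[of b] by blast
    then have "Poly_Mapping.lookup (F P) (int n) = Poly_Mapping.lookup (F Q) (int n)" for n by simp
    then show "P = Q" by (intro poly_eqI) (simp add: F)
  qed
  then show ?thesis
    using hom zero diff mult[of _ "int i" _ "int j" for i j] B0
    by (intro positively_graded.intro positively_graded_axioms.intro) auto
qed

theorem corollary5p2:
  shows "(U2_GR :: ('k::alg_closed_field \<Rightarrow> 'b::ufd) set set) = U2_AGR \<and>
    (\<forall>\<iota> :: 'k \<Rightarrow> 'b.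
       comm_ring_hom \<iota> \<longrightarrow>
       has_transcendence_degree \<iota> 2 \<longrightarrow>
       rational2_over \<iota> \<longrightarrow>
       (\<exists>B. positive_grading_over \<iota> B) \<longrightarrow>
       affine_over \<iota>)"
proof -
  have affine: "affine_over \<iota>"
    if "comm_ring_hom \<iota>" "rational2_over \<iota>" "\<exists>B. positive_grading_over \<iota> B" for \<iota> :: "'k \<Rightarrow> 'b"
    using that positive_grading_imp_positively_graded graded_rational_ufd_affine by blast
  \<comment> \<open>Both sets of classes are quotients by \<open>k_isomorphic\<close>, so it is
    enough that the underlying sets of embeddings coincide.\<close>
  then have "{\<iota> :: 'k \<Rightarrow> 'b. comm_ring_hom \<iota> \<and> has_transcendence_degree \<iota> 2 \<and>
        (\<exists>B. positive_grading_over \<iota> B) \<and> rational2_over \<iota>} =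
      {\<iota>. comm_ring_hom \<iota> \<and> has_transcendence_degree \<iota> 2 \<and> affine_over \<iota> \<and>
        (\<exists>B. positive_grading_over \<iota> B) \<and> rational2_over \<iota>}"
    by blast
  with affine show ?thesis unfolding U2_GR_def U2_AGR_def by auto
qed

end
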